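(* For all $n$, \[\mathrm{ex}_o(n,E) = \binom{n}{3},\] and for each $n$ there is exactly one $E$-free oriented graph on $n$ vertices with $\binom{n}{3}$ edges, up to isomorphism.
   Context: A $2\to1$ directed hypergraph (here simply a "graph") is a pair $H=(V,E)$ with $V$ a finite vertex set and $E$ a set of edges, each edge being a 3-element subset $\{a,b,c\}$ of $V$ with one element marked as the head; the edge with underlying set $\{a,b,c\}$ and head $c$ is written $ab \to c$. $H$ is oriented if every 3-subset of $V$ carries at most one edge. A homomorphism $\phi:F\to G$ is a map $V(F)\to V(G)$ with $ab\to c\in E(F)\Rightarrow \phi(a)\phi(b)\to\phi(c)\in E(G)$. $G$ is $F$-free if there is no injective homomorphism $F\to G$. $\mathrm{ex}_o(n,F)$ is the maximum number of edges of an $F$-free oriented graph on $n$ vertices. The Escher graph $E$ has vertex set $\{a,b,c,d\}$ and edge set $\{ab\to c,\ cd\to b\}$. *)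

theory Defs
  imports Complex_Main
begin

text \<open>An edge is a pair of its underlying 3-element set and its head.\<close>

record 'a hgraph =
  verts :: "'a set"
  edges :: "('a set \<times> 'a) set"

definition arrow :: "'a \<Rightarrow> 'a \<Rightarrow> 'a \<Rightarrow> 'a set \<times> 'a" where
  "arrow a b c = ({a, b, c}, c)"

definition wf_hgraph :: "'a hgraph \<Rightarrow> bool" where
  "wf_hgraph G \<longleftrightarrow> finite (verts G) \<and>
     (\<forall>(S, c) \<in> edges G. S \<subseteq> verts G \<and> card S = 3 \<and> c \<in> S)"

definition oriented :: "'a hgraph \<Rightarrow> bool" where
  "oriented G \<longleftrightarrow> wf_hgraph G \<and>
     (\<forall>S c d. (S, c) \<in> edges G \<longrightarrow> (S, d) \<in> edges G \<longrightarrow> c = d)"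

definition hom :: "('a \<Rightarrow> 'b) \<Rightarrow> 'a hgraph \<Rightarrow> 'b hgraph \<Rightarrow> bool" where
  "hom \<phi> F G \<longleftrightarrow> \<phi> ` verts F \<subseteq> verts G \<and>
     (\<forall>a b c. arrow a b c \<in> edges F \<longrightarrow> arrow (\<phi> a) (\<phi> b) (\<phi> c) \<in> edges G)"

definition free_of :: "'b hgraph \<Rightarrow> 'a hgraph \<Rightarrow> bool" where
  "free_of F G \<longleftrightarrow> \<not> (\<exists>\<phi>. hom \<phi> F G \<and> inj_on \<phi> (verts F))"

definition isomorphic :: "'a hgraph \<Rightarrow> 'b hgraph \<Rightarrow> bool" where
  "isomorphic G H \<longleftrightarrow> (\<exists>\<phi>. bij_betw \<phi> (verts G) (verts H) \<and>
     (\<forall>a\<in>verts G. \<forall>b\<in>verts G. \<forall>c\<in>verts G.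
        arrow a b c \<in> edges G \<longleftrightarrow> arrow (\<phi> a) (\<phi> b) (\<phi> c) \<in> edges H))"

text \<open>Every graph has an isomorphic copy on a set of natural numbers, so taking the
  maximum over graphs whose vertices are natural numbers is no restriction.\<close>

definition ex_o :: "nat \<Rightarrow> 'b hgraph \<Rightarrow> nat" where
  "ex_o n F = Max {card (edges G) | G :: nat hgraph.
     oriented G \<and> card (verts G) = n \<and> free_of F G}"

datatype escher_vertex = Va | Vb | Vc | Vd

definition escher :: "escher_vertex hgraph" where
  "escher = \<lparr>verts = {Va, Vb, Vc, Vd}, edges = {arrow Va Vb Vc, arrow Vc Vd Vb}\<rparr>"

end

theory Submission
  imports Defs
begin

text \<open>
  In an oriented graph every 3-set carries at most one edge, which gives the upper bound; letting
  the largest element of each 3-subset of \<open>{..<n}\<close> be its head attains it.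
  For uniqueness, say that \<open>c\<close> dominates \<open>b\<close> if some edge contains both and has head \<open>c\<close>.
  Escher-freeness makes this relation asymmetric, and if every 3-set carries an edge, it is also
  transitive. A maximal vertex is then the head of every edge through it, and removing maximal
  vertices one at a time orders the vertices so that each edge points to its last vertex.
\<close>

section \<open>Edges and copies of the Escher graph\<close>

lemma arrow_commute: "arrow a b c = arrow b a c"
  unfolding arrow_def by (simp add: insert_commute)

lemma card_3_iff_distinct: "card {a, b, c} = 3 \<longleftrightarrow> a \<noteq> b \<and> a \<noteq> c \<and> b \<noteq> c"
  by (auto simp: card_insert_if)

lemma arrow_edge_wf:
  assumes "wf_hgraph G" "arrow a b c \<in> edges G"
  shows "a \<noteq> b" "a \<noteq> c" "b \<noteq> c" "a \<in> verts G" "b \<in> verts G" "c \<in> verts G"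
proof -
  have "card {a, b, c} = 3" "{a, b, c} \<subseteq> verts G"
    using assms unfolding wf_hgraph_def arrow_def by auto
  then show "a \<noteq> b" "a \<noteq> c" "b \<noteq> c" "a \<in> verts G" "b \<in> verts G" "c \<in> verts G"
    unfolding card_3_iff_distinct by auto
qed

text \<open>Each of the two edges has three distinct vertices, so \<open>a\<close> and
  \<open>d\<close> form the only pair that might still coincide; injectivity reduces to keeping
  these two apart.\<close>

lemma free_of_escher_iff:
  assumes "wf_hgraph G"
  shows "free_of escher G \<longleftrightarrow>
    (\<forall>a b c d. a \<noteq> d \<longrightarrow> arrow a b c \<in> edges G \<longrightarrow> arrow c d b \<notin> edges G)"
proof
  assume free: "free_of escher G"
  show "\<forall>a b c d. a \<noteq> d \<longrightarrow> arrow a b c \<in> edges G \<longrightarrow> arrow c d b \<notin> edges G"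
  proof (intro allI impI notI)
    fix a b c d
    assume ad: "a \<noteq> d" and e: "arrow a b c \<in> edges G" "arrow c d b \<in> edges G"
    note wf = arrow_edge_wf[OF assms e(1)] arrow_edge_wf[OF assms e(2)]
    define \<phi> where "\<phi> x = (case x of Va \<Rightarrow> a | Vb \<Rightarrow> b | Vc \<Rightarrow> c | Vd \<Rightarrow> d)" for x
    have [simp]: "\<phi> Va = a" "\<phi> Vb = b" "\<phi> Vc = c" "\<phi> Vd = d"
      by (simp_all add: \<phi>_def)
    \<comment> \<open>An equation between arrows fixes the first two vertices only up to a swap.
      Expressing the image through the edge itself avoids splitting into these cases.\<close>
    have image: "arrow (\<phi> x) (\<phi> y) (\<phi> z) = (\<phi> ` fst (arrow x y z), \<phi> (snd (arrow x y z)))" for x y z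
      by (simp add: arrow_def)
    have "hom \<phi> escher G"
      unfolding hom_def
    proof (intro conjI allI impI)
      show "\<phi> ` verts escher \<subseteq> verts G"
        using wf by (simp add: escher_def)
      fix x y z
      assume "arrow x y z \<in> edges escher"
      then consider "arrow x y z = arrow Va Vb Vc" | "arrow x y z = arrow Vc Vd Vb"
        by (auto simp: escher_def)
      then show "arrow (\<phi> x) (\<phi> y) (\<phi> z) \<in> edges G"
      proof cases
        case 1
        then have "arrow (\<phi> x) (\<phi> y) (\<phi> z) = arrow a b c"
          by (simp only: image) (simp add: arrow_def)
        then show ?thesis using e by simp
      next
        case 2
        then have "arrow (\<phi> x) (\<phi> y) (\<phi> z) = arrow c d b"
          by (simp only: image) (simp add: arrow_def)
        then show ?thesis using e by simp
      qed
    qed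
    moreover have "inj_on \<phi> (verts escher)"
      using wf ad by (auto simp: escher_def)
    ultimately show False
      using free unfolding free_of_def by blast
  qed
next
  assume no: "\<forall>a b c d. a \<noteq> d \<longrightarrow> arrow a b c \<in> edges G \<longrightarrow> arrow c d b \<notin> edges G"
  show "free_of escher G"
    unfolding free_of_def
  proof
    assume "\<exists>\<phi>. hom \<phi> escher G \<and> inj_on \<phi> (verts escher)"
    then obtain \<phi> where \<phi>: "hom \<phi> escher G" "inj_on \<phi> (verts escher)"
      by blast
    have "arrow (\<phi> Va) (\<phi> Vb) (\<phi> Vc) \<in> edges G" "arrow (\<phi> Vc) (\<phi> Vd) (\<phi> Vb) \<in> edges G"
      using \<phi>(1) unfolding hom_def escher_def by auto
    moreover have "\<phi> Va \<noteq> \<phi> Vd"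
      using \<phi>(2) by (auto simp: escher_def)
    ultimately show False
      using no by blast
  qed
qed

section \<open>Domination as a strict order\<close>

definition dominates :: "'a hgraph \<Rightarrow> 'a \<Rightarrow> 'a \<Rightarrow> bool" where
  "dominates G c b \<longleftrightarrow> (\<exists>a. arrow a b c \<in> edges G)"

text \<open>Mutual domination gives two edges through \<open>b\<close> and \<open>c\<close> with
  opposite heads. If their third vertices agree, one 3-set has two heads; otherwise the edges form
  an Escher graph.\<close>

lemma dominates_asym:
  assumes "oriented G" "free_of escher G" "dominates G c b"
  shows "\<not> dominates G b c"
proof
  have wf: "wf_hgraph G"
    using assms(1) by (simp add: oriented_def)
  assume "dominates G b c"
  then obtain a d where e: "arrow a b c \<in> edges G" "arrow d c b \<in> edges G"
    using assms(3) by (auto simp: dominates_def)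
  show False
  proof (cases "a = d")
    case True
    then have "({a, b, c}, c) \<in> edges G" "({a, b, c}, b) \<in> edges G"
      using e by (auto simp: arrow_def insert_commute)
    then have "b = c"
      using assms(1) unfolding oriented_def by blast
    then show False
      using arrow_edge_wf(3)[OF wf e(1)] by simp
  next
    case False
    then show False
      using e assms(2) unfolding free_of_escher_iff[OF wf] by (metis arrow_commute)
  qed
qed

text \<open>The form in which a maximal edge count enters the uniqueness argument, see
  \<open>complete_hgraph_if_card_edges\<close>.\<close>

definition complete_hgraph :: "'a hgraph \<Rightarrow> bool" where
  "complete_hgraph G \<longleftrightarrow> (\<forall>S\<subseteq>verts G. card S = 3 \<longrightarrow> (\<exists>c. (S, c) \<in> edges G))"

lemma complete_hgraph_arrow:
  assumes "wf_hgraph G" "complete_hgraph G"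
    and "{x, y, z} \<subseteq> verts G" "x \<noteq> y" "x \<noteq> z" "y \<noteq> z"
  shows "arrow y z x \<in> edges G \<or> arrow x z y \<in> edges G \<or> arrow x y z \<in> edges G"
proof -
  have "card {x, y, z} = 3"
    using assms by (simp add: card_3_iff_distinct)
  then obtain c where c: "({x, y, z}, c) \<in> edges G"
    using assms unfolding complete_hgraph_def by blast
  then have "c \<in> {x, y, z}"
    using assms(1) by (auto simp: wf_hgraph_def)
  then show ?thesis
    using c by (auto simp: arrow_def insert_commute)
qed

text \<open>Consider the edge on \<open>{x, y, z}\<close>. With head \<open>x\<close> it would make
  \<open>x\<close> dominate \<open>y\<close>, with head \<open>y\<close> it would make
  \<open>y\<close> dominate \<open>z\<close>; asymmetry excludes both, so the head is
  \<open>z\<close>.\<close>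

lemma dominates_trans:
  assumes "oriented G" "free_of escher G" "complete_hgraph G"
    and yx: "dominates G y x" and zy: "dominates G z y"
  shows "dominates G z x"
proof -
  note asym = dominates_asym[OF assms(1,2)]
  have wf: "wf_hgraph G"
    using assms(1) by (simp add: oriented_def)
  have "x \<in> verts G" "y \<in> verts G" "z \<in> verts G" "x \<noteq> y" "y \<noteq> z"
    using yx zy arrow_edge_wf[OF wf] unfolding dominates_def by blast+
  moreover have "x \<noteq> z"
    using asym[OF yx] zy by auto
  ultimately have "arrow y z x \<in> edges G \<or> arrow x z y \<in> edges G \<or> arrow x y z \<in> edges G"
    using complete_hgraph_arrow[OF wf assms(3)] by simp
  then show ?thesis
    using asym[OF yx] asym[OF zy] unfolding dominates_def by (metis arrow_commute)
qed

lemma exists_undominated: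
  assumes "oriented G" "free_of escher G" "complete_hgraph G"
    and "finite W" "W \<noteq> {}"
  shows "\<exists>v\<in>W. \<forall>w\<in>W. \<not> dominates G w v"
proof -
  let ?R = "\<lambda>x y. dominates G y x"
  have "asymp_on W ?R"
    using dominates_asym[OF assms(1,2)] by (intro asymp_onI)
  moreover have "transp_on W ?R"
    using dominates_trans[OF assms(1-3)] by (intro transp_onI)
  ultimately obtain v where "v \<in> W" "\<forall>x\<in>W. x \<noteq> v \<longrightarrow> \<not> dominates G x v"
    using Finite_Set.bex_max_element[of W ?R] assms(4,5) by auto
  \<comment> \<open>Maximality speaks only of elements other than \<open>v\<close>; asymmetry covers
    \<open>v\<close> itself.\<close>
  moreover have "\<not> dominates G v v"
    using dominates_asym[OF assms(1,2)] by blast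
  ultimately show ?thesis
    by metis
qed

text \<open>The induction runs over vertex subsets \<open>W\<close> of a fixed \<open>G\<close>, so
  the hypotheses on \<open>G\<close> need not be transferred to subgraphs. A vertex undominated in
  \<open>W\<close> is numbered last.\<close>

lemma complete_escher_free_enumeration:
  assumes G: "oriented G" "free_of escher G" "complete_hgraph G"
    and "W \<subseteq> verts G" "card W = m"
  shows "\<exists>\<phi>. bij_betw \<phi> {..<m} W \<and>
    (\<forall>a<m. \<forall>b<m. \<forall>c<m.
       arrow (\<phi> a) (\<phi> b) (\<phi> c) \<in> edges G \<longleftrightarrow> a \<noteq> b \<and> a < c \<and> b < c)"
  using assms(4,5)
proof (induction m arbitrary: W)
  case 0
  \<comment> \<open>An infinite \<open>W\<close> would also have cardinality 0; finiteness makes it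
    empty.\<close>
  have "finite W"
    using 0 G(1) finite_subset by (auto simp: oriented_def wf_hgraph_def)
  then show ?case
    using 0 by (auto simp: bij_betw_def)
next
  case (Suc m)
  have wf: "wf_hgraph G"
    using G(1) by (simp add: oriented_def)
  have "finite W" "W \<noteq> {}"
    using Suc.prems(2) by (auto intro: card_ge_0_finite)
  then obtain v where v: "v \<in> W" and top: "\<forall>w\<in>W. \<not> dominates G w v"
    using exists_undominated[OF G] by blast
  have "W - {v} \<subseteq> verts G" "card (W - {v}) = m"
    using Suc.prems v by auto
  then obtain \<phi> where bij: "bij_betw \<phi> {..<m} (W - {v})"
    and \<phi>: "\<forall>a<m. \<forall>b<m. \<forall>c<m.
      arrow (\<phi> a) (\<phi> b) (\<phi> c) \<in> edges G \<longleftrightarrow> a \<noteq> b \<and> a < c \<and> b < c"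
    using Suc.IH[of "W - {v}"] by blast
  define \<psi> where "\<psi> = \<phi>(m := v)"
  have \<psi>_less: "\<psi> i = \<phi> i" if "i < m" for i
    using that by (simp add: \<psi>_def)
  have \<psi>_m: "\<psi> m = v"
    by (simp add: \<psi>_def)
  have "bij_betw \<psi> {..<m} (W - {v})"
    using bij \<psi>_less by (subst bij_betw_cong[where g = \<phi>]) auto
  then have bij': "bij_betw \<psi> {..<Suc m} W"
    using notIn_Un_bij_betw[of m "{..<m}" \<psi> "W - {v}"] \<psi>_m v
    by (simp add: lessThan_Suc insert_absorb)
  have inW: "\<psi> i \<in> W" if "i < Suc m" for i
    using bij' that by (auto simp: bij_betw_def)
  have inj: "\<psi> i = \<psi> j \<longleftrightarrow> i = j" if "i < Suc m" "j < Suc m" for i j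
    using bij' that by (auto simp: bij_betw_def inj_on_def)
  \<comment> \<open>Such an edge would make \<open>w\<close> dominate \<open>v\<close>.\<close>
  have no_top: "arrow x v w \<notin> edges G" "arrow v x w \<notin> edges G" if "w \<in> W" for x w
    using top that unfolding dominates_def by (metis arrow_commute)+
  have "arrow (\<psi> a) (\<psi> b) (\<psi> c) \<in> edges G \<longleftrightarrow> a \<noteq> b \<and> a < c \<and> b < c"
    if abc: "a < Suc m" "b < Suc m" "c < Suc m" for a b c
  proof
    assume e: "arrow (\<psi> a) (\<psi> b) (\<psi> c) \<in> edges G"
    have "a \<noteq> b" "a \<noteq> c" "b \<noteq> c"
      using arrow_edge_wf(1-3)[OF wf e] by auto
    \<comment> \<open>So \<open>m\<close> can only be the head, where the inequalities are
      immediate; otherwise all three indices are below \<open>m\<close> and the induction hypothesis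
      applies.\<close>
    moreover have "a \<noteq> m" "b \<noteq> m"
      using e no_top inW[OF abc(3)] \<psi>_m by auto
    ultimately show "a \<noteq> b \<and> a < c \<and> b < c"
      using e abc \<phi> \<psi>_less by (cases "c = m") auto
  next
    assume lt: "a \<noteq> b \<and> a < c \<and> b < c"
    show "arrow (\<psi> a) (\<psi> b) (\<psi> c) \<in> edges G"
    proof (cases "c = m")
      case True
      have "{\<psi> a, \<psi> b, \<psi> c} \<subseteq> verts G"
        using inW abc Suc.prems(1) by blast
      \<comment> \<open>Completeness puts some edge on this 3-set, and \<open>no_top\<close> rules
        out every head but \<open>v\<close>.\<close>
      then have "arrow (\<psi> b) (\<psi> c) (\<psi> a) \<in> edges G \<or> arrow (\<psi> a) (\<psi> c) (\<psi> b) \<in> edges G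
          \<or> arrow (\<psi> a) (\<psi> b) (\<psi> c) \<in> edges G"
        using lt abc by (intro complete_hgraph_arrow[OF wf G(3)]) (auto simp: inj)
      then show ?thesis
        using no_top inW abc \<psi>_m True by metis
    next
      case False
      then show ?thesis
        using lt abc \<phi> \<psi>_less by auto
    qed
  qed
  then show ?case
    using bij' by blast
qed

section \<open>The extremal graph\<close>

definition max_head_hgraph :: "nat \<Rightarrow> nat hgraph" where
  "max_head_hgraph n =
    \<lparr>verts = {..<n}, edges = (\<lambda>S. (S, Max S)) ` {S. S \<subseteq> {..<n} \<and> card S = 3}\<rparr>"

lemma verts_max_head_hgraph [simp]: "verts (max_head_hgraph n) = {..<n}"
  by (simp add: max_head_hgraph_def)

lemma arrow_in_max_head_hgraph_iff:
  "arrow a b c \<in> edges (max_head_hgraph n) \<longleftrightarrow> a \<noteq> b \<and> a < c \<and> b < c \<and> c < n"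
proof -
  have "arrow a b c \<in> edges (max_head_hgraph n) \<longleftrightarrow>
      {a, b, c} \<subseteq> {..<n} \<and> card {a, b, c} = 3 \<and> Max {a, b, c} = c"
    unfolding max_head_hgraph_def arrow_def by (simp add: image_iff eq_commute[of c] del: Max_insert)
  then show ?thesis
    unfolding card_3_iff_distinct by (auto simp: max_def split: if_splits)
qed

lemma oriented_max_head_hgraph: "oriented (max_head_hgraph n)"
proof -
  have "Max S \<in> S" if "card S = 3" for S :: "nat set"
    using that by (intro Max_in) (auto intro: card_ge_0_finite)
  then show ?thesis
    by (auto simp: oriented_def wf_hgraph_def max_head_hgraph_def)
qed

text \<open>Heads are maximal, so the two edges of an Escher graph would require both
  \<open>b < c\<close> and \<open>c < b\<close>.\<close>

lemma free_of_escher_max_head_hgraph: "free_of escher (max_head_hgraph n)"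
proof -
  have "wf_hgraph (max_head_hgraph n)"
    using oriented_max_head_hgraph by (simp add: oriented_def)
  then show ?thesis
    by (auto simp: free_of_escher_iff arrow_in_max_head_hgraph_iff)
qed

lemma card_edges_max_head_hgraph: "card (edges (max_head_hgraph n)) = n choose 3"
proof -
  have "card (edges (max_head_hgraph n)) = card {S. S \<subseteq> {..<n} \<and> card S = 3}"
    by (auto simp: max_head_hgraph_def intro!: card_image inj_onI)
  then show ?thesis
    using n_subsets[of "{..<n}" 3] by simp
qed

section \<open>The upper bound and its equality case\<close>

lemma oriented_edges_underlying:
  assumes "oriented G"
  shows "inj_on fst (edges G)" "fst ` edges G \<subseteq> {S. S \<subseteq> verts G \<and> card S = 3}"
    "finite {S. S \<subseteq> verts G \<and> card S = 3}"
    "card {S. S \<subseteq> verts G \<and> card S = 3} = card (verts G) choose 3"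
proof -
  have fin: "finite (verts G)"
    using assms by (simp add: oriented_def wf_hgraph_def)
  show "inj_on fst (edges G)"
    using assms unfolding oriented_def by (intro inj_onI) (metis prod.collapse)
  show "fst ` edges G \<subseteq> {S. S \<subseteq> verts G \<and> card S = 3}"
    using assms unfolding oriented_def wf_hgraph_def by fastforce
  show "finite {S. S \<subseteq> verts G \<and> card S = 3}"
    using fin by simp
  show "card {S. S \<subseteq> verts G \<and> card S = 3} = card (verts G) choose 3"
    using n_subsets[OF fin] .
qed

lemma card_edges_oriented_le:
  assumes "oriented G"
  shows "card (edges G) \<le> card (verts G) choose 3"
  using card_mono[OF oriented_edges_underlying(3,2)[OF assms]]
    card_image[OF oriented_edges_underlying(1)[OF assms]]
    oriented_edges_underlying(4)[OF assms] by simp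

text \<open>The underlying sets of the edges then form a subfamily of the finitely many 3-subsets
  with the same cardinality, hence all of them.\<close>

lemma complete_hgraph_if_card_edges:
  assumes "oriented G" "card (edges G) = card (verts G) choose 3"
  shows "complete_hgraph G"
proof -
  have "fst ` edges G = {S. S \<subseteq> verts G \<and> card S = 3}"
    using oriented_edges_underlying[OF assms(1)] assms(2)
    by (intro card_subset_eq) (auto simp: card_image)
  then show ?thesis
    unfolding complete_hgraph_def by force
qed

lemma max_head_hgraph_isomorphic:
  assumes "oriented G" "free_of escher G" "complete_hgraph G"
  shows "isomorphic (max_head_hgraph (card (verts G))) G"
proof -
  obtain \<phi> where "bij_betw \<phi> {..<card (verts G)} (verts G)"
    and "\<forall>a<card (verts G). \<forall>b<card (verts G). \<forall>c<card (verts G).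
       arrow (\<phi> a) (\<phi> b) (\<phi> c) \<in> edges G \<longleftrightarrow> a \<noteq> b \<and> a < c \<and> b < c"
    using complete_escher_free_enumeration[OF assms subset_refl refl] by blast
  then show ?thesis
    unfolding isomorphic_def
    by (intro exI[of _ \<phi>]) (auto simp: arrow_in_max_head_hgraph_iff)
qed

theorem theorem5:
  fixes n :: nat
  shows "ex_o n escher = n choose 3 \<and>
    (\<exists>G :: nat hgraph.
       oriented G \<and> card (verts G) = n \<and> free_of escher G \<and> card (edges G) = n choose 3 \<and>
       (\<forall>H :: 'a hgraph.
          oriented H \<and> card (verts H) = n \<and> free_of escher H \<and> card (edges H) = n choose 3
          \<longrightarrow> isomorphic G H))"
proof
  let ?C = "{card (edges G) | G :: nat hgraph.
     oriented G \<and> card (verts G) = n \<and> free_of escher G}"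
  note extremal = oriented_max_head_hgraph[of n] free_of_escher_max_head_hgraph[of n]
    card_edges_max_head_hgraph[of n]
  have bound: "k \<le> n choose 3" if "k \<in> ?C" for k
    using that card_edges_oriented_le by blast
  \<comment> \<open>The vertices may be any \<open>n\<close> naturals, so finiteness comes from
    bounding the edge counts, not from counting graphs.\<close>
  have "finite ?C"
    using bound by (intro finite_subset[of ?C "{..n choose 3}"]) auto
  moreover have "n choose 3 \<in> ?C"
    using extremal by (intro CollectI exI[of _ "max_head_hgraph n"]) simp
  ultimately show "ex_o n escher = n choose 3"
    unfolding ex_o_def using bound by (intro Max_eqI)
  \<comment> \<open>The witness depends only on \<open>n\<close>, so it serves every
    \<open>H\<close> at once, whatever its vertex type.\<close>
  show "\<exists>G :: nat hgraph.
       oriented G \<and> card (verts G) = n \<and> free_of escher G \<and> card (edges G) = n choose 3 \<and>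
       (\<forall>H :: 'a hgraph.
          oriented H \<and> card (verts H) = n \<and> free_of escher H \<and> card (edges H) = n choose 3
          \<longrightarrow> isomorphic G H)"
    using extremal complete_hgraph_if_card_edges max_head_hgraph_isomorphic
    by (intro exI[of _ "max_head_hgraph n"]) auto
qed

end
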